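(* Let $\mathsf{CS}$ be an axiomatically appropriate and schematic constant specification for $\mathsf{JEM}$. There exists a normal realization $r$ such that for every modal formula $A$: if $\mathsf{GM}\vdash\ \supset A$, then $\mathsf{JEM}_{\mathsf{CS}}\vdash r(A)$.
   Context: Justification language. Fix countably many proof constants $\alpha_i$, proof variables $\xi_i$, justification variables $x_i$, and a countable set $\mathsf{Prop}$ of atomic propositions. Proof terms: $\lambda ::= \alpha_i \mid \xi_i \mid (\lambda\cdot\lambda) \mid\ !\lambda$. Justification terms: $t ::= x_i \mid t+t \mid \mathsf{m}(\lambda,t)$. Formulas: $F ::= P\mid\bot\mid(F\to F)\mid\lambda:F\mid[t]F$; other connectives are classical abbreviations. Axioms of $\mathsf{JEM}$: all instances of classical propositional tautologies and of (j) $\lambda:(F\to G)\to(\kappa:F\to\lambda\cdot\kappa:G)$; (jt) $\lambda:F\to F$; (j4) $\lambda:F\to\ !\lambda:\lambda:F$; (jm) $\lambda:(F\to G)\to([t]F\to[\mathsf{m}(\lambda,t)]G)$; (j+$_2$) $([t]F\vee[s]F)\to[t+s]F$. A constant specification $\mathsf{CS}$ is a set of pairs $(\alpha,A)$, $\alpha$ a proof constant, $A$ an axiom of $\mathsf{JEM}$; it is axiomatically appropriate if every axiom has some constant $\alpha$ with $(\alpha,A)\in\mathsf{CS}$, and schematic if for each constant $c$ the set $\{A\mid(c,A)\in\mathsf{CS}\}$ consists of all instances of one or several (possibly zero) axiom schemes of $\mathsf{JEM}$. $\mathsf{JEM}_{\mathsf{CS}}$ is the Hilbert system with these axioms, modus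 ponens, and axiom necessitation (infer $\alpha:A$ whenever $(\alpha,A)\in\mathsf{CS}$). Modal language: $A ::= P\mid\bot\mid(A\to A)\mid\Box A$. The sequent calculus $\mathsf{GM}$ works with sequents $\Gamma\supset\Delta$ ($\Gamma,\Delta$ finite multisets) and has: axioms $P\supset P$ and $\bot\supset$; rules $(\to\supset)$: from $\Gamma\supset\Delta,A$ and $B,\Gamma\supset\Delta$ infer $A\to B,\Gamma\supset\Delta$; $(\supset\to)$: from $A,\Gamma\supset\Delta,B$ infer $\Gamma\supset\Delta,A\to B$; weakening and contraction on both sides; and (RM): from $A\supset B$ infer $\Box A\supset\Box B$. Realization. Let $\mathsf{Fm}^{\mathsf J}$ be the justification formulas with no subformula of the form $\lambda:F$. The forgetful translation is $\bot^\circ=\bot$, $P^\circ=P$, $(A\to B)^\circ=A^\circ\to B^\circ$, $([t]A)^\circ=\Box A^\circ$. A realization is a map $r$ from modal formulas to $\mathsf{Fm}^{\mathsf J}$ with $(r(A))^\circ=A$. Polarity of subformula occurrences in a formula $A$: $A$ itself is positive; if $B\to C$ has some polarity then $C$ has the same and $B$ the opposite polarity; if $\Box B$ has some polarity then $B$ has the same. An occurrence of $\Box$ is negative (positive) if the subformula occurrence $\Box B$ it heads is negative (positive). A realization $r$ is normal if, for each $A$, in $r(A)$ all negative occurrences of $\Box$ of $A$ are realized by (i.e. replaced by $[x]$ with) justification variables, distinct occurrences receiving distinct variables. *)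

theory Defs
  imports "HOL-Library.Multiset" "HOL-Library.Countable"
begin

section \<open>Justification language\<close>

datatype ptm = PConst nat | PVar nat | PApp ptm ptm | Bang ptm

datatype jtm = JVar nat | JSum jtm jtm | JM ptm jtm

datatype 'p jfm =
    JAtom 'p
  | JBot
  | JImp "'p jfm" "'p jfm"  (infixr \<open>\<^bold>\<rightarrow>\<close> 60)
  | JPrf ptm "'p jfm"
  | JBox jtm "'p jfm"

abbreviation JNeg :: "'p jfm \<Rightarrow> 'p jfm" where
  "JNeg F \<equiv> F \<^bold>\<rightarrow> JBot"

abbreviation JOr :: "'p jfm \<Rightarrow> 'p jfm \<Rightarrow> 'p jfm" where
  "JOr F G \<equiv> JNeg F \<^bold>\<rightarrow> G"

section \<open>The logic JEM\<close>

text \<open>Propositional formulas over schematic letters; they serve as the schemes whose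
  instances are the tautology axioms.\<close>

datatype pfm = PLetter nat | PBot | PImp pfm pfm

primrec peval :: "(nat \<Rightarrow> bool) \<Rightarrow> pfm \<Rightarrow> bool" where
  "peval V (PLetter i) = V i"
| "peval V PBot = False"
| "peval V (PImp a b) = (peval V a \<longrightarrow> peval V b)"

definition tautology :: "pfm \<Rightarrow> bool" where
  "tautology q \<longleftrightarrow> (\<forall>V. peval V q)"

primrec pinst :: "(nat \<Rightarrow> 'p jfm) \<Rightarrow> pfm \<Rightarrow> 'p jfm" where
  "pinst \<sigma> (PLetter i) = \<sigma> i"
| "pinst \<sigma> PBot = JBot"
| "pinst \<sigma> (PImp a b) = pinst \<sigma> a \<^bold>\<rightarrow> pinst \<sigma> b"

text \<open>A scheme is identified with the set of its instances.
  Every propositional tautology is a scheme of its own.\<close>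

definition taut_scheme :: "pfm \<Rightarrow> 'p jfm set" where
  "taut_scheme q = {pinst \<sigma> q | \<sigma>. True}"

definition j_scheme :: "'p jfm set" where
  "j_scheme = {JPrf l (F \<^bold>\<rightarrow> G) \<^bold>\<rightarrow> (JPrf k F \<^bold>\<rightarrow> JPrf (PApp l k) G) | l k F G. True}"

definition jt_scheme :: "'p jfm set" where
  "jt_scheme = {JPrf l F \<^bold>\<rightarrow> F | l F. True}"

definition j4_scheme :: "'p jfm set" where
  "j4_scheme = {JPrf l F \<^bold>\<rightarrow> JPrf (Bang l) (JPrf l F) | l F. True}"

definition jm_scheme :: "'p jfm set" where
  "jm_scheme = {JPrf l (F \<^bold>\<rightarrow> G) \<^bold>\<rightarrow> (JBox t F \<^bold>\<rightarrow> JBox (JM l t) G) | l t F G. True}"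

definition jplus_scheme :: "'p jfm set" where
  "jplus_scheme = {JOr (JBox t F) (JBox s F) \<^bold>\<rightarrow> JBox (JSum t s) F | t s F. True}"

definition axiom_schemes :: "'p jfm set set" where
  "axiom_schemes = {taut_scheme q | q. tautology q}
     \<union> {j_scheme, jt_scheme, j4_scheme, jm_scheme, jplus_scheme}"

definition JEM_axioms :: "'p jfm set" where
  "JEM_axioms = \<Union> axiom_schemes"

type_synonym 'p const_spec = "(nat \<times> 'p jfm) set"

definition constant_specification :: "'p const_spec \<Rightarrow> bool" where
  "constant_specification CS \<longleftrightarrow> (\<forall>(c, A) \<in> CS. A \<in> JEM_axioms)"

definition axiomatically_appropriate :: "'p const_spec \<Rightarrow> bool" where
  "axiomatically_appropriate CS \<longleftrightarrow> (\<forall>A \<in> JEM_axioms. \<exists>c. (c, A) \<in> CS)"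

definition schematic :: "'p const_spec \<Rightarrow> bool" where
  "schematic CS \<longleftrightarrow> (\<forall>c. \<exists>S \<subseteq> axiom_schemes. {A. (c, A) \<in> CS} = \<Union> S)"

inductive JEM :: "'p const_spec \<Rightarrow> 'p jfm \<Rightarrow> bool" for CS where
  ax: "A \<in> JEM_axioms \<Longrightarrow> JEM CS A"
| mp: "JEM CS (A \<^bold>\<rightarrow> B) \<Longrightarrow> JEM CS A \<Longrightarrow> JEM CS B"
| an: "(c, A) \<in> CS \<Longrightarrow> JEM CS (JPrf (PConst c) A)"

section \<open>Modal language and the sequent calculus GM\<close>

datatype 'p mfm = MAtom 'p | MBot | MImp "'p mfm" "'p mfm" | MBox "'p mfm"

inductive GM :: "'p mfm multiset \<Rightarrow> 'p mfm multiset \<Rightarrow> bool" where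
  ax: "GM {#MAtom P#} {#MAtom P#}"
| bot: "GM {#MBot#} {#}"
| impL: "GM \<Gamma> (add_mset A \<Delta>) \<Longrightarrow> GM (add_mset B \<Gamma>) \<Delta> \<Longrightarrow> GM (add_mset (MImp A B) \<Gamma>) \<Delta>"
| impR: "GM (add_mset A \<Gamma>) (add_mset B \<Delta>) \<Longrightarrow> GM \<Gamma> (add_mset (MImp A B) \<Delta>)"
| weakL: "GM \<Gamma> \<Delta> \<Longrightarrow> GM (add_mset A \<Gamma>) \<Delta>"
| weakR: "GM \<Gamma> \<Delta> \<Longrightarrow> GM \<Gamma> (add_mset A \<Delta>)"
| contrL: "GM (add_mset A (add_mset A \<Gamma>)) \<Delta> \<Longrightarrow> GM (add_mset A \<Gamma>) \<Delta>"
| contrR: "GM \<Gamma> (add_mset A (add_mset A \<Delta>)) \<Longrightarrow> GM \<Gamma> (add_mset A \<Delta>)"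
| RM: "GM {#A#} {#B#} \<Longrightarrow> GM {#MBox A#} {#MBox B#}"

section \<open>Realizations\<close>

text \<open>Subformula occurrences are addressed by paths from the root: antecedent or consequent
  of an implication, or body of a modal prefix.\<close>

datatype dir = Ante | Conseq | Body

text \<open>\<open>mocc A p s B\<close>: the subformula occurrence of \<open>A\<close> at path \<open>p\<close> is \<open>B\<close>, with positive
  polarity if \<open>s\<close> is true and negative polarity otherwise.\<close>

inductive mocc :: "'p mfm \<Rightarrow> dir list \<Rightarrow> bool \<Rightarrow> 'p mfm \<Rightarrow> bool" for A where
  root: "mocc A [] True A"
| ante: "mocc A p s (MImp B C) \<Longrightarrow> mocc A (p @ [Ante]) (\<not> s) B"
| cons: "mocc A p s (MImp B C) \<Longrightarrow> mocc A (p @ [Conseq]) s C"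
| body: "mocc A p s (MBox B) \<Longrightarrow> mocc A (p @ [Body]) s B"

definition neg_boxes :: "'p mfm \<Rightarrow> dir list set" where
  "neg_boxes A = {p. \<exists>B. mocc A p False (MBox B)}"

inductive jocc :: "'p jfm \<Rightarrow> dir list \<Rightarrow> 'p jfm \<Rightarrow> bool" for F where
  root: "jocc F [] F"
| ante: "jocc F p (G \<^bold>\<rightarrow> H) \<Longrightarrow> jocc F (p @ [Ante]) G"
| cons: "jocc F p (G \<^bold>\<rightarrow> H) \<Longrightarrow> jocc F (p @ [Conseq]) H"
| prf_body: "jocc F p (JPrf l G) \<Longrightarrow> jocc F (p @ [Body]) G"
| box_body: "jocc F p (JBox t G) \<Longrightarrow> jocc F (p @ [Body]) G"

definition FmJ :: "'p jfm set" where
  "FmJ = {F. \<nexists>p l G. jocc F p (JPrf l G)}"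

text \<open>Only meaningful on \<open>FmJ\<close>; the value on \<open>JPrf\<close> formulas is left unspecified.\<close>

primrec (nonexhaustive) forget :: "'p jfm \<Rightarrow> 'p mfm" where
  "forget JBot = MBot"
| "forget (JAtom P) = MAtom P"
| "forget (F \<^bold>\<rightarrow> G) = MImp (forget F) (forget G)"
| "forget (JBox t F) = MBox (forget F)"

definition realization :: "('p mfm \<Rightarrow> 'p jfm) \<Rightarrow> bool" where
  "realization r \<longleftrightarrow> (\<forall>A. r A \<in> FmJ \<and> forget (r A) = A)"

text \<open>For a realization \<open>r\<close>, the formulas \<open>A\<close> and \<open>r A\<close> have the same paths. The assignment
  \<open>v\<close> of variables to negative boxes may depend on \<open>A\<close>.\<close>

definition normal :: "('p mfm \<Rightarrow> 'p jfm) \<Rightarrow> bool" where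
  "normal r \<longleftrightarrow> (\<forall>A. \<exists>v. inj_on v (neg_boxes A) \<and>
     (\<forall>p \<in> neg_boxes A. \<exists>G. jocc (r A) p (JBox (JVar (v p)) G)))"

end

theory Submission imports Defs begin

text \<open>Annotate every box occurrence of a formula by its own justification variable. Since cut is
  absent, the annotation propagates through a whole \<open>GM\<close>-derivation, and each application of
  \<open>RM\<close> relates a negative variable \<open>x\<close> to a positive variable \<open>u\<close>. Number all these
  applications \<open>0, \<dots>, N - 1\<close>; the final substitution replaces \<open>u\<close> by an \<open>N\<close>-fold sum whose
  \<open>i\<close>-th summand is \<open>m(\<lambda>, x)\<close>, where \<open>\<lambda>\<close> internalizes the premise of the \<open>i\<close>-th
  application if that application introduces \<open>u\<close>, and is irrelevant otherwise. There is no
  circularity: proof terms contain no justification terms, so, the constant specification being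
  schematic, a single \<open>\<lambda>\<close> works for all substitution instances of the premise, in particular
  for those obtained by the substitution that mentions \<open>\<lambda>\<close>.\<close>

section \<open>Boolean valuations and substitutions of justification formulas\<close>

instance ptm :: countable by countable_datatype
instance jtm :: countable by countable_datatype
instance jfm :: (countable) countable by countable_datatype
instance dir :: countable by countable_datatype

primrec beval :: "('p jfm \<Rightarrow> bool) \<Rightarrow> 'p jfm \<Rightarrow> bool" where
  "beval W (JAtom P) = W (JAtom P)"
| "beval W JBot = False"
| "beval W (F \<^bold>\<rightarrow> G) = (beval W F \<longrightarrow> beval W G)"
| "beval W (JPrf l F) = W (JPrf l F)"
| "beval W (JBox t F) = W (JBox t F)"

lemma beval_pinst: "beval W (pinst \<sigma> q) = peval (\<lambda>i. beval W (\<sigma> i)) q"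
  by (induction q) auto

lemma beval_taut_scheme: "A \<in> taut_scheme q \<Longrightarrow> tautology q \<Longrightarrow> beval W A"
  by (auto simp: taut_scheme_def tautology_def beval_pinst)

primrec tsubst :: "(nat \<Rightarrow> jtm) \<Rightarrow> jtm \<Rightarrow> jtm" where
  "tsubst \<theta> (JVar n) = \<theta> n"
| "tsubst \<theta> (JSum s t) = JSum (tsubst \<theta> s) (tsubst \<theta> t)"
| "tsubst \<theta> (JM l t) = JM l (tsubst \<theta> t)"

primrec subst :: "(nat \<Rightarrow> jtm) \<Rightarrow> 'p jfm \<Rightarrow> 'p jfm" where
  "subst \<theta> (JAtom P) = JAtom P"
| "subst \<theta> JBot = JBot"
| "subst \<theta> (F \<^bold>\<rightarrow> G) = subst \<theta> F \<^bold>\<rightarrow> subst \<theta> G"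
| "subst \<theta> (JPrf l F) = JPrf l (subst \<theta> F)"
| "subst \<theta> (JBox t F) = JBox (tsubst \<theta> t) (subst \<theta> F)"

text \<open>Letters code the propositional atoms of \<open>F\<close> before any substitution, so the
  single scheme \<open>skeleton F\<close> covers all substitution instances of
  \<open>F\<close>.\<close>

primrec skeleton :: "'p::countable jfm \<Rightarrow> pfm" where
  "skeleton (JAtom P) = PLetter (to_nat (JAtom P))"
| "skeleton JBot = PBot"
| "skeleton (F \<^bold>\<rightarrow> G) = PImp (skeleton F) (skeleton G)"
| "skeleton (JPrf l F) = PLetter (to_nat (JPrf l F))"
| "skeleton (JBox t F) = PLetter (to_nat (JBox t F))"

lemma peval_skeleton: "peval V (skeleton F) = beval (\<lambda>G. V (to_nat G)) F"
  by (induction F) auto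

lemma pinst_skeleton: "pinst (\<lambda>n. subst \<theta> (from_nat n)) (skeleton F) = subst \<theta> F"
  by (induction F) auto

section \<open>Constants for whole schemes\<close>

text \<open>An axiom may be an instance of several schemes, and the constant given by axiomatic
  appropriateness may stand for any of them. The required scheme is forced by looking at an
  instance that is as generic as possible; for tautologies, distinct letters become distinct
  boxed formulas.\<close>

abbreviation generic_letter :: "nat \<Rightarrow> 'p jfm" where
  "generic_letter i \<equiv> JBox (JVar i) JBot"

text \<open>A left inverse of \<open>pinst generic_letter\<close>; the value \<open>PBot\<close> on
  atoms, \<open>JPrf\<close> formulas and boxes with composite terms is arbitrary.\<close>

primrec letters_of :: "'p jfm \<Rightarrow> pfm" where
  "letters_of (JAtom P) = PBot"
| "letters_of JBot = PBot"
| "letters_of (F \<^bold>\<rightarrow> G) = PImp (letters_of F) (letters_of G)"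
| "letters_of (JPrf l F) = PBot"
| "letters_of (JBox t F) = (case t of JVar i \<Rightarrow> PLetter i | _ \<Rightarrow> PBot)"

lemma letters_of_generic: "letters_of (pinst generic_letter q) = q"
  by (induction q) auto

lemma pinst_letters_of:
  "pinst (\<lambda>i. pinst \<sigma> (letters_of (\<tau> i))) q = pinst \<sigma> (letters_of (pinst \<tau> q))"
  by (induction q) auto

text \<open>Applying \<open>letters_of\<close> to the equation behind the assumption exhibits
  \<open>q\<close> itself as a substitution instance of \<open>q'\<close>.\<close>

lemma taut_scheme_mono:
  assumes "(pinst generic_letter q :: 'p jfm) \<in> taut_scheme q'"
  shows "(pinst \<sigma> q :: 'p jfm) \<in> taut_scheme q'"
proof -
  obtain \<tau> :: "nat \<Rightarrow> 'p jfm" where "pinst generic_letter q = pinst \<tau> q'"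
    using assms by (auto simp: taut_scheme_def)
  then have "pinst \<sigma> q = pinst (\<lambda>i. pinst \<sigma> (letters_of (\<tau> i))) q'"
    by (metis letters_of_generic pinst_letters_of)
  then show ?thesis by (auto simp: taut_scheme_def)
qed

text \<open>Every instance of the five schemes other than tautologies violates this: outside all box
  bodies it has a \<open>JPrf\<close> formula or a box labelled by a sum.\<close>

primrec box_var_only :: "'p jfm \<Rightarrow> bool" where
  "box_var_only (JAtom P) = True"
| "box_var_only JBot = True"
| "box_var_only (F \<^bold>\<rightarrow> G) = (box_var_only F \<and> box_var_only G)"
| "box_var_only (JPrf l F) = False"
| "box_var_only (JBox t F) = (\<exists>i. t = JVar i)"

lemma box_var_only_generic: "box_var_only (pinst generic_letter q)"
  by (induction q) auto

lemma generic_not_in_other_schemes: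
  "(pinst generic_letter q :: 'p jfm) \<notin> j_scheme \<union> jt_scheme \<union> j4_scheme \<union> jm_scheme \<union> jplus_scheme"
proof
  assume "(pinst generic_letter q :: 'p jfm) \<in>
    j_scheme \<union> jt_scheme \<union> j4_scheme \<union> jm_scheme \<union> jplus_scheme"
  then have "\<not> box_var_only (pinst generic_letter q :: 'p jfm)"
    by (auto simp: j_scheme_def jt_scheme_def j4_scheme_def jm_scheme_def jplus_scheme_def)
  then show False by (simp add: box_var_only_generic)
qed

locale schematic_spec =
  fixes CS :: "'p::countable const_spec"
  assumes appropriate: "axiomatically_appropriate CS"
    and schematic: "schematic CS"
begin

text \<open>The constant for \<open>A\<close> covers a union of schemes, hence all of the scheme
  \<open>X\<close> through which it covers \<open>A\<close>. This \<open>X\<close> need not be the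
  scheme that \<open>A\<close> was taken from.\<close>

lemma scheme_of_axiom:
  assumes "A \<in> JEM_axioms"
  shows "\<exists>c. \<exists>X\<in>axiom_schemes. A \<in> X \<and> (\<forall>B\<in>X. (c, B) \<in> CS)"
proof -
  obtain c where c: "(c, A) \<in> CS"
    using assms appropriate by (auto simp: axiomatically_appropriate_def)
  have "\<exists>S\<subseteq>axiom_schemes. {A. (c, A) \<in> CS} = \<Union> S"
    using schematic by (simp add: schematic_def)
  then obtain S where S: "S \<subseteq> axiom_schemes" "{A. (c, A) \<in> CS} = \<Union> S"
    by (elim exE conjE)
  have "A \<in> \<Union> S" using c by (simp flip: S(2))
  then obtain X where X: "X \<in> S" "A \<in> X" by (rule UnionE)
  have "(c, B) \<in> CS" if "B \<in> X" for B
    using UnionI[OF X(1) that] by (simp flip: S(2))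
  with X S(1) show ?thesis by auto
qed

lemma taut_const:
  assumes "tautology q"
  shows "\<exists>c. \<forall>\<sigma>. (c, pinst \<sigma> q) \<in> CS"
proof -
  have "(pinst generic_letter q :: 'p jfm) \<in> JEM_axioms"
    using assms by (auto simp: JEM_axioms_def axiom_schemes_def taut_scheme_def)
  then obtain c and X :: "'p jfm set" where X: "X \<in> axiom_schemes" "pinst generic_letter q \<in> X"
    and c: "\<forall>B\<in>X. (c, B) \<in> CS"
    by (blast dest: scheme_of_axiom)
  obtain q' where "X = taut_scheme q'"
    using X generic_not_in_other_schemes[where 'p = 'p, of q] by (auto simp: axiom_schemes_def)
  then have "pinst \<sigma> q \<in> X" for \<sigma>
    using X(2) taut_scheme_mono by simp
  then show ?thesis using c by blast
qed

lemma jm_const: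
  "\<exists>c. \<forall>l t F G. (c, JPrf l (F \<^bold>\<rightarrow> G) \<^bold>\<rightarrow> (JBox t F \<^bold>\<rightarrow> JBox (JM l t) G)) \<in> CS"
proof -
  define A :: "'p jfm" where
    "A = JPrf (PVar 0) (JBot \<^bold>\<rightarrow> JBot) \<^bold>\<rightarrow> (JBox (JVar 0) JBot \<^bold>\<rightarrow> JBox (JM (PVar 0) (JVar 0)) JBot)"
  have "A \<in> JEM_axioms"
    by (auto simp: A_def JEM_axioms_def axiom_schemes_def jm_scheme_def)
  then obtain c X where X: "X \<in> axiom_schemes" "A \<in> X"
    and c: "\<forall>B\<in>X. (c, B) \<in> CS"
    by (blast dest: scheme_of_axiom)
  \<comment> \<open>Every propositional atom holds except the final box of \<open>A\<close>, which
    rules out the tautology schemes; the others fail by shape.\<close>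
  have "\<not> beval (\<lambda>F. F \<noteq> JBox (JM (PVar 0) (JVar 0)) JBot) A"
    by (simp add: A_def)
  then have "A \<notin> taut_scheme q" if "tautology q" for q
    using beval_taut_scheme that by blast
  moreover have "A \<notin> j_scheme \<union> jt_scheme \<union> j4_scheme \<union> jplus_scheme"
    by (auto simp: A_def j_scheme_def jt_scheme_def j4_scheme_def jplus_scheme_def)
  ultimately have "X = jm_scheme"
    using X by (auto simp: axiom_schemes_def)
  then have "JPrf l (F \<^bold>\<rightarrow> G) \<^bold>\<rightarrow> (JBox t F \<^bold>\<rightarrow> JBox (JM l t) G) \<in> X" for l t F G
    unfolding jm_scheme_def by blast
  then show ?thesis using c by blast
qed

lemma jplus_const:
  "\<exists>c. \<forall>t s F. (c, JOr (JBox t F) (JBox s F) \<^bold>\<rightarrow> JBox (JSum t s) F) \<in> CS"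
proof -
  define A :: "'p jfm" where
    "A = JOr (JBox (JVar 0) JBot) (JBox (JVar 0) JBot) \<^bold>\<rightarrow> JBox (JSum (JVar 0) (JVar 0)) JBot"
  have "A \<in> JEM_axioms"
    by (auto simp: A_def JEM_axioms_def axiom_schemes_def jplus_scheme_def)
  then obtain c X where X: "X \<in> axiom_schemes" "A \<in> X"
    and c: "\<forall>B\<in>X. (c, B) \<in> CS"
    by (blast dest: scheme_of_axiom)
  have "\<not> beval (\<lambda>F. F = JBox (JVar 0) JBot) A"
    by (simp add: A_def)
  then have "A \<notin> taut_scheme q" if "tautology q" for q
    using beval_taut_scheme that by blast
  moreover have "A \<notin> j_scheme \<union> jt_scheme \<union> j4_scheme \<union> jm_scheme"
    by (auto simp: A_def j_scheme_def jt_scheme_def j4_scheme_def jm_scheme_def)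
  ultimately have "X = jplus_scheme"
    using X by (auto simp: axiom_schemes_def)
  then have "JOr (JBox t F) (JBox s F) \<^bold>\<rightarrow> JBox (JSum t s) F \<in> X" for t s F
    unfolding jplus_scheme_def by blast
  then show ?thesis using c by blast
qed

section \<open>Uniform internalization\<close>

text \<open>The order of quantifiers matters: one proof term serves the whole family, so it may be
  fixed before the substitutions that will mention it.\<close>

definition uniform :: "'i set \<Rightarrow> ('i \<Rightarrow> 'p jfm) \<Rightarrow> bool" where
  "uniform I f \<longleftrightarrow> (\<exists>l. \<forall>i\<in>I. JEM CS (JPrf l (f i)))"

lemma JEM_reflect: "JEM CS (JPrf l F) \<Longrightarrow> JEM CS F"
  by (rule JEM.mp[OF JEM.ax]) (auto simp: JEM_axioms_def axiom_schemes_def jt_scheme_def)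

lemma JEM_j: "JEM CS (JPrf l (F \<^bold>\<rightarrow> G)) \<Longrightarrow> JEM CS (JPrf k F) \<Longrightarrow> JEM CS (JPrf (PApp l k) G)"
  by (rule JEM.mp[OF JEM.mp[OF JEM.ax, of "JPrf l (F \<^bold>\<rightarrow> G)" "JPrf k F \<^bold>\<rightarrow> JPrf (PApp l k) G"]])
    (auto simp: JEM_axioms_def axiom_schemes_def j_scheme_def)

lemma JEM_j4: "JEM CS (JPrf l F) \<Longrightarrow> JEM CS (JPrf (Bang l) (JPrf l F))"
  by (rule JEM.mp[OF JEM.ax]) (auto simp: JEM_axioms_def axiom_schemes_def j4_scheme_def)

lemma uniform_mono: "uniform J f \<Longrightarrow> I \<subseteq> J \<Longrightarrow> uniform I f"
  unfolding uniform_def by blast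

lemma uniform_mp: "uniform I (\<lambda>i. f i \<^bold>\<rightarrow> g i) \<Longrightarrow> uniform I f \<Longrightarrow> uniform I g"
  unfolding uniform_def by (blast intro: JEM_j)

lemma uniform_const: "(\<And>i. i \<in> I \<Longrightarrow> (c, f i) \<in> CS) \<Longrightarrow> uniform I f"
  unfolding uniform_def by (meson JEM.an)

lemma uniform_pinst: "tautology q \<Longrightarrow> uniform I (\<lambda>i. pinst (\<sigma> i) q)"
  by (metis taut_const uniform_const)

lemma uniform_taut:
  assumes "\<And>W. beval W F"
  shows "uniform I (\<lambda>\<theta>. subst \<theta> F)"
proof -
  have "tautology (skeleton F)"
    using assms by (simp add: tautology_def peval_skeleton)
  from uniform_pinst[OF this, of I "\<lambda>\<theta> n. subst \<theta> (from_nat n)"]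
  show ?thesis by (simp add: pinst_skeleton)
qed

lemma uniform_taut_conseq:
  assumes "uniform I (\<lambda>\<theta>. subst \<theta> F)" "\<And>W. beval W F \<Longrightarrow> beval W G"
  shows "uniform I (\<lambda>\<theta>. subst \<theta> G)"
  using uniform_mp[of I "\<lambda>\<theta>. subst \<theta> F"] uniform_taut[of "F \<^bold>\<rightarrow> G" I] assms by simp

lemma uniform_conj:
  assumes "uniform I (\<lambda>\<theta>. subst \<theta> F)" "uniform I (\<lambda>\<theta>. subst \<theta> G)"
  shows "uniform I (\<lambda>\<theta>. subst \<theta> (JNeg (F \<^bold>\<rightarrow> JNeg G)))"
  using uniform_taut[of "F \<^bold>\<rightarrow> (G \<^bold>\<rightarrow> JNeg (F \<^bold>\<rightarrow> JNeg G))" I] assms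
  by (auto intro: uniform_mp)

lemma uniform_trans:
  assumes "uniform I (\<lambda>i. f i \<^bold>\<rightarrow> g i)" "uniform I (\<lambda>i. g i \<^bold>\<rightarrow> h i)"
  shows "uniform I (\<lambda>i. f i \<^bold>\<rightarrow> h i)"
proof -
  let ?q = "PImp (PImp (PLetter 0) (PLetter 1)) (PImp (PImp (PLetter 1) (PLetter 2))
    (PImp (PLetter 0) (PLetter 2)))"
  have "tautology ?q" by (auto simp: tautology_def)
  from uniform_pinst[OF this, of I "\<lambda>i n. if n = 0 then f i else if n = 1 then g i else h i"]
  show ?thesis using assms by (auto intro: uniform_mp)
qed

text \<open>One constant proves all the instances of (jm), and (j4) yields \<open>Bang l\<close> as
  a proof of their antecedents for every \<open>i\<close>. The terms \<open>t i\<close> may vary, as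
  no proof term contains them.\<close>

lemma uniform_jm:
  assumes "\<And>i. i \<in> I \<Longrightarrow> JEM CS (JPrf l (f i \<^bold>\<rightarrow> g i))"
  shows "uniform I (\<lambda>i. JBox (t i) (f i) \<^bold>\<rightarrow> JBox (JM l (t i)) (g i))"
proof (rule uniform_mp)
  show "uniform I (\<lambda>i. JPrf l (f i \<^bold>\<rightarrow> g i) \<^bold>\<rightarrow> (JBox (t i) (f i) \<^bold>\<rightarrow> JBox (JM l (t i)) (g i)))"
    using jm_const uniform_const by meson
  show "uniform I (\<lambda>i. JPrf l (f i \<^bold>\<rightarrow> g i))"
    using assms JEM_j4 unfolding uniform_def by blast
qed

lemma uniform_jplus:
  shows "uniform I (\<lambda>i. JBox (t i) (f i) \<^bold>\<rightarrow> JBox (JSum (t i) (s i)) (f i))"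
    and "uniform I (\<lambda>i. JBox (s i) (f i) \<^bold>\<rightarrow> JBox (JSum (t i) (s i)) (f i))"
proof -
  have *: "uniform I (\<lambda>i. JOr (JBox (t i) (f i)) (JBox (s i) (f i)) \<^bold>\<rightarrow> JBox (JSum (t i) (s i)) (f i))"
    using jplus_const uniform_const by meson
  have "tautology (PImp (PLetter 0) (PImp (PImp (PLetter 0) PBot) (PLetter 1)))"
    by (auto simp: tautology_def)
  from uniform_pinst[OF this, of I "\<lambda>i n. if n = 0 then JBox (t i) (f i) else JBox (s i) (f i)"]
  show "uniform I (\<lambda>i. JBox (t i) (f i) \<^bold>\<rightarrow> JBox (JSum (t i) (s i)) (f i))"
    by (intro uniform_trans[OF _ *]) simp
  have "tautology (PImp (PLetter 1) (PImp (PImp (PLetter 0) PBot) (PLetter 1)))"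
    by (auto simp: tautology_def)
  from uniform_pinst[OF this, of I "\<lambda>i n. if n = 0 then JBox (t i) (f i) else JBox (s i) (f i)"]
  show "uniform I (\<lambda>i. JBox (s i) (f i) \<^bold>\<rightarrow> JBox (JSum (t i) (s i)) (f i))"
    by (intro uniform_trans[OF _ *]) simp
qed

end

text \<open>The base case is a dummy summand, since there is no empty sum.\<close>

primrec jsum :: "(nat \<Rightarrow> jtm) \<Rightarrow> nat \<Rightarrow> jtm" where
  "jsum u 0 = JVar 0"
| "jsum u (Suc n) = JSum (jsum u n) (u n)"

text \<open>The proof term is determined by \<open>m\<close> and \<open>N\<close> alone, so
  \<open>u\<close> and \<open>f\<close> may vary freely with \<open>i\<close>.\<close>

lemma (in schematic_spec) uniform_jsum:
  "m < N \<Longrightarrow> uniform I (\<lambda>i. JBox (u i m) (f i) \<^bold>\<rightarrow> JBox (jsum (u i) N) (f i))"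
proof (induction N)
  case (Suc N)
  show ?case
  proof (cases "m = N")
    case True
    then show ?thesis using uniform_jplus(2) by simp
  next
    case False
    with Suc have "uniform I (\<lambda>i. JBox (u i m) (f i) \<^bold>\<rightarrow> JBox (jsum (u i) N) (f i))" by simp
    from uniform_trans[OF this uniform_jplus(1)] show ?thesis by simp
  qed
qed simp

section \<open>Annotated formulas\<close>

text \<open>Coding the polarity keeps negative variables apart from the positive ones, which alone
  are replaced in the end.\<close>

definition box_var :: "bool \<Rightarrow> dir list \<Rightarrow> nat" where
  "box_var s p = to_nat (s, p)"

lemma box_var_inject [simp]: "box_var s p = box_var s' p' \<longleftrightarrow> s = s' \<and> p = p'"
  by (simp add: box_var_def)

primrec annotate :: "bool \<Rightarrow> dir list \<Rightarrow> 'p mfm \<Rightarrow> 'p jfm" where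
  "annotate s p (MAtom P) = JAtom P"
| "annotate s p MBot = JBot"
| "annotate s p (MImp A B) = annotate (\<not> s) (p @ [Ante]) A \<^bold>\<rightarrow> annotate s (p @ [Conseq]) B"
| "annotate s p (MBox A) = JBox (JVar (box_var s p)) (annotate s (p @ [Body]) A)"

text \<open>The value \<open>\<phi> m = (n, t)\<close> records that the \<open>m\<close>-th application of \<open>RM\<close> introduces the
  positive variable \<open>n\<close> and requires \<open>t\<close> among its summands.\<close>

definition resolve :: "nat \<Rightarrow> (nat \<Rightarrow> nat \<times> jtm) \<Rightarrow> nat \<Rightarrow> jtm" where
  "resolve N \<phi> n = (if n \<in> range (box_var True)
     then jsum (\<lambda>m. if fst (\<phi> m) = n then snd (\<phi> m) else JVar 0) N else JVar n)"

lemma resolve_neg: "resolve N \<phi> (box_var False p) = JVar (box_var False p)"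
  by (auto simp: resolve_def)

lemma resolve_pos:
  "resolve N \<phi> (box_var True p) =
    jsum (\<lambda>m. if fst (\<phi> m) = box_var True p then snd (\<phi> m) else JVar 0) N"
  by (simp add: resolve_def)

text \<open>The substitutions still possible once the entries in \<open>M\<close> are fixed. The
  others stay open, so proof terms found for a subderivation survive the treatment of the
  rest.\<close>

definition resolutions :: "nat \<Rightarrow> nat set \<Rightarrow> (nat \<Rightarrow> nat \<times> jtm) \<Rightarrow> (nat \<Rightarrow> jtm) set" where
  "resolutions N M \<phi> = {resolve N \<psi> | \<psi>. \<forall>m\<in>M. \<psi> m = \<phi> m}"

lemma resolutions_mono:
  assumes "M \<subseteq> M'" "\<And>m. m \<in> M \<Longrightarrow> \<phi> m = \<phi>' m"
  shows "resolutions N M' \<phi>' \<subseteq> resolutions N M \<phi>"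
  using assms unfolding resolutions_def by fastforce

lemma resolve_in_resolutions: "resolve N \<phi> \<in> resolutions N M \<phi>"
  unfolding resolutions_def by blast

definition seq_true ::
  "('p jfm \<Rightarrow> bool) \<Rightarrow> (dir list \<times> 'p mfm) multiset \<Rightarrow> (dir list \<times> 'p mfm) multiset \<Rightarrow> bool" where
  "seq_true W \<Gamma> \<Delta> \<longleftrightarrow> (\<forall>(p, A) \<in># \<Gamma>. beval W (annotate False p A)) \<longrightarrow>
     (\<exists>(p, A) \<in># \<Delta>. beval W (annotate True p A))"

section \<open>Realization of derivations\<close>

context schematic_spec
begin

text \<open>Any \<open>F\<close> that propositionally entails the sequent may stand for it, so the
  multisets need not be encoded as a formula.\<close>

definition realizable_at ::
  "nat \<Rightarrow> nat set \<Rightarrow> (dir list \<times> 'p mfm) multiset \<Rightarrow> (dir list \<times> 'p mfm) multiset \<Rightarrow> bool" where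
  "realizable_at N M \<Gamma> \<Delta> \<longleftrightarrow> (\<exists>\<phi> F. uniform (resolutions N M \<phi>) (\<lambda>\<theta>. subst \<theta> F) \<and>
     (\<forall>W. beval W F \<longrightarrow> seq_true W \<Gamma> \<Delta>))"

text \<open>Here \<open>k\<close> is the number of applications of \<open>RM\<close> in the derivation. The total number \<open>N\<close>
  has to be arbitrary but known in advance: the proof term for a summand inclusion depends on it.\<close>

definition realizable ::
  "(dir list \<times> 'p mfm) multiset \<Rightarrow> (dir list \<times> 'p mfm) multiset \<Rightarrow> bool" where
  "realizable \<Gamma> \<Delta> \<longleftrightarrow> (\<exists>k. \<forall>N a. a + k \<le> N \<longrightarrow> realizable_at N {a..<a + k} \<Gamma> \<Delta>)"

lemma realizable_mono:
  assumes "realizable \<Gamma> \<Delta>" "\<And>W. seq_true W \<Gamma> \<Delta> \<Longrightarrow> seq_true W \<Gamma>' \<Delta>'"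
  shows "realizable \<Gamma>' \<Delta>'"
proof -
  have "realizable_at N M \<Gamma>' \<Delta>'" if "realizable_at N M \<Gamma> \<Delta>" for N M
    using that assms(2) unfolding realizable_at_def by blast
  then show ?thesis using assms(1) unfolding realizable_def by blast
qed

lemma realizable_taut:
  assumes "\<And>W. seq_true W \<Gamma> \<Delta>"
  shows "realizable \<Gamma> \<Delta>"
proof -
  have "realizable_at N M \<Gamma> \<Delta>" for N M
    unfolding realizable_at_def
    using assms uniform_taut[of "JBot \<^bold>\<rightarrow> JBot"] by (intro exI[of _ "JBot \<^bold>\<rightarrow> JBot"] exI conjI) auto
  then show ?thesis unfolding realizable_def by blast
qed

lemma realizable_combine:
  assumes "realizable \<Gamma>\<^sub>1 \<Delta>\<^sub>1" "realizable \<Gamma>\<^sub>2 \<Delta>\<^sub>2"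
    and comb: "\<And>W. seq_true W \<Gamma>\<^sub>1 \<Delta>\<^sub>1 \<Longrightarrow> seq_true W \<Gamma>\<^sub>2 \<Delta>\<^sub>2 \<Longrightarrow> seq_true W \<Gamma> \<Delta>"
  shows "realizable \<Gamma> \<Delta>"
proof -
  obtain k\<^sub>1 where k\<^sub>1: "\<And>N a. a + k\<^sub>1 \<le> N \<Longrightarrow> realizable_at N {a..<a + k\<^sub>1} \<Gamma>\<^sub>1 \<Delta>\<^sub>1"
    using assms(1) unfolding realizable_def by blast
  obtain k\<^sub>2 where k\<^sub>2: "\<And>N a. a + k\<^sub>2 \<le> N \<Longrightarrow> realizable_at N {a..<a + k\<^sub>2} \<Gamma>\<^sub>2 \<Delta>\<^sub>2"
    using assms(2) unfolding realizable_def by blast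
  have "realizable_at N {a..<a + (k\<^sub>1 + k\<^sub>2)} \<Gamma> \<Delta>" if N: "a + (k\<^sub>1 + k\<^sub>2) \<le> N" for N a
  proof -
    obtain \<phi>\<^sub>1 F\<^sub>1 where 1: "uniform (resolutions N {a..<a + k\<^sub>1} \<phi>\<^sub>1) (\<lambda>\<theta>. subst \<theta> F\<^sub>1)"
      and F1: "\<And>W. beval W F\<^sub>1 \<Longrightarrow> seq_true W \<Gamma>\<^sub>1 \<Delta>\<^sub>1"
      using k\<^sub>1[of a N] N unfolding realizable_at_def by auto
    obtain \<phi>\<^sub>2 F\<^sub>2 where 2: "uniform (resolutions N {a + k\<^sub>1..<a + k\<^sub>1 + k\<^sub>2} \<phi>\<^sub>2) (\<lambda>\<theta>. subst \<theta> F\<^sub>2)"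
      and F2: "\<And>W. beval W F\<^sub>2 \<Longrightarrow> seq_true W \<Gamma>\<^sub>2 \<Delta>\<^sub>2"
      using k\<^sub>2[of "a + k\<^sub>1" N] N unfolding realizable_at_def by auto
    \<comment> \<open>The premises use adjacent disjoint blocks of indices, so their records can be
      glued.\<close>
    define \<phi> where "\<phi> m = (if m < a + k\<^sub>1 then \<phi>\<^sub>1 m else \<phi>\<^sub>2 m)" for m
    let ?R = "resolutions N {a..<a + (k\<^sub>1 + k\<^sub>2)} \<phi>"
    have "uniform ?R (\<lambda>\<theta>. subst \<theta> F\<^sub>1)"
      by (rule uniform_mono[OF 1 resolutions_mono]) (auto simp: \<phi>_def)
    moreover have "uniform ?R (\<lambda>\<theta>. subst \<theta> F\<^sub>2)"
      by (rule uniform_mono[OF 2 resolutions_mono]) (auto simp: \<phi>_def)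
    ultimately have "uniform ?R (\<lambda>\<theta>. subst \<theta> (JNeg (F\<^sub>1 \<^bold>\<rightarrow> JNeg F\<^sub>2)))"
      by (rule uniform_conj)
    moreover have "seq_true W \<Gamma> \<Delta>" if "beval W (JNeg (F\<^sub>1 \<^bold>\<rightarrow> JNeg F\<^sub>2))" for W
      using that F1 F2 comb by auto
    ultimately show ?thesis unfolding realizable_at_def by blast
  qed
  then show ?thesis unfolding realizable_def by blast
qed

lemma realizable_RM:
  assumes "realizable {#(p @ [Body], A)#} {#(q @ [Body], B)#}"
  shows "realizable {#(p, MBox A)#} {#(q, MBox B)#}"
proof -
  define X Y where "X = annotate False (p @ [Body]) A" and "Y = annotate True (q @ [Body]) B"
  obtain k where k: "\<And>N a. a + k \<le> N \<Longrightarrow>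
      realizable_at N {a..<a + k} {#(p @ [Body], A)#} {#(q @ [Body], B)#}"
    using assms unfolding realizable_def by blast
  have "realizable_at N {a..<a + Suc k} {#(p, MBox A)#} {#(q, MBox B)#}"
    if N: "a + Suc k \<le> N" for N a
  proof -
    obtain \<phi> F where F: "uniform (resolutions N {a..<a + k} \<phi>) (\<lambda>\<theta>. subst \<theta> F)"
      and "\<And>W. beval W F \<Longrightarrow> seq_true W {#(p @ [Body], A)#} {#(q @ [Body], B)#}"
      using k[of a N] N unfolding realizable_at_def by auto
    then have "\<And>W. beval W F \<Longrightarrow> beval W (X \<^bold>\<rightarrow> Y)"
      by (simp add: seq_true_def X_def Y_def)
    from uniform_taut_conseq[OF F this] obtain l where
      l: "\<And>\<theta>. \<theta> \<in> resolutions N {a..<a + k} \<phi> \<Longrightarrow> JEM CS (JPrf l (subst \<theta> X \<^bold>\<rightarrow> subst \<theta> Y))"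
      by (auto simp: uniform_def)
    define x u where "x = box_var False p" and "u = box_var True q"
    \<comment> \<open>Index \<open>a + k\<close>, the last of the block, is reserved for this
      application. The term \<open>l\<close> works for all substitutions agreeing with
      \<open>\<phi>\<close> on the preceding indices, including those that now mention
      \<open>l\<close>.\<close>
    define \<phi>' where "\<phi>' = \<phi>(a + k := (u, JM l (JVar x)))"
    \<comment> \<open>Families are indexed by \<open>\<psi>\<close> for now, because the summands
      are read off from \<open>\<psi>\<close> and not from the substitution.\<close>
    define \<Psi> where "\<Psi> = {\<psi>. \<forall>m\<in>{a..<a + Suc k}. \<psi> m = \<phi>' m}"
    have "resolve N \<psi> \<in> resolutions N {a..<a + k} \<phi>" if "\<psi> \<in> \<Psi>" for \<psi>
      using that unfolding resolutions_def \<Psi>_def \<phi>'_def by auto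
    with l have "uniform \<Psi> (\<lambda>\<psi>. JBox (JVar x) (subst (resolve N \<psi>) X)
        \<^bold>\<rightarrow> JBox (JM l (JVar x)) (subst (resolve N \<psi>) Y))"
      by (intro uniform_jm) blast
    moreover have "uniform \<Psi> (\<lambda>\<psi>. JBox (JM l (JVar x)) (subst (resolve N \<psi>) Y)
        \<^bold>\<rightarrow> JBox (resolve N \<psi> u) (subst (resolve N \<psi>) Y))"
    proof -
      let ?u = "\<lambda>\<psi> m. if fst (\<psi> m) = u then snd (\<psi> m) else JVar 0"
      have "uniform \<Psi> (\<lambda>\<psi>. JBox (?u \<psi> (a + k)) (subst (resolve N \<psi>) Y)
          \<^bold>\<rightarrow> JBox (jsum (?u \<psi>) N) (subst (resolve N \<psi>) Y))"
        using N by (intro uniform_jsum) simp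
      moreover have "?u \<psi> (a + k) = JM l (JVar x)" if "\<psi> \<in> \<Psi>" for \<psi>
        using that by (simp add: \<Psi>_def \<phi>'_def)
      ultimately show ?thesis
        by (simp add: uniform_def u_def resolve_pos)
    qed
    ultimately have "uniform \<Psi> (\<lambda>\<psi>. JBox (JVar x) (subst (resolve N \<psi>) X)
        \<^bold>\<rightarrow> JBox (resolve N \<psi> u) (subst (resolve N \<psi>) Y))"
      by (rule uniform_trans)
    then have "uniform (resolutions N {a..<a + Suc k} \<phi>')
        (\<lambda>\<theta>. subst \<theta> (JBox (JVar x) X \<^bold>\<rightarrow> JBox (JVar u) Y))"
      unfolding uniform_def resolutions_def \<Psi>_def by (fastforce simp: x_def resolve_neg)
    moreover have "seq_true W {#(p, MBox A)#} {#(q, MBox B)#}"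
      if "beval W (JBox (JVar x) X \<^bold>\<rightarrow> JBox (JVar u) Y)" for W
      using that by (simp add: seq_true_def X_def Y_def x_def u_def)
    ultimately show ?thesis unfolding realizable_at_def by blast
  qed
  then show ?thesis unfolding realizable_def by blast
qed

text \<open>Path labels are arbitrary in the conclusion and are extended upwards by each logical
  rule. The antecedent of an implication changes side and polarity together, so the annotations
  match.\<close>

lemma GM_realizable:
  assumes "GM \<Gamma> \<Delta>"
  shows "image_mset snd \<Gamma>' = \<Gamma> \<Longrightarrow> image_mset snd \<Delta>' = \<Delta> \<Longrightarrow> realizable \<Gamma>' \<Delta>'"
  using assms
proof (induction arbitrary: \<Gamma>' \<Delta>' rule: GM.induct)
  case (ax P)
  then obtain p q where "\<Gamma>' = {#(p, MAtom P)#}" "\<Delta>' = {#(q, MAtom P)#}"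
    by (auto dest!: msed_map_invR)
  then show ?case by (auto intro!: realizable_taut simp: seq_true_def)
next
  case bot
  then obtain p where "\<Gamma>' = {#(p, MBot)#}" by (auto dest!: msed_map_invR)
  then show ?case by (auto intro!: realizable_taut simp: seq_true_def)
next
  case (impL \<Gamma> A \<Delta> B)
  then obtain p \<Gamma>'' where \<Gamma>': "\<Gamma>' = add_mset (p, MImp A B) \<Gamma>''" "image_mset snd \<Gamma>'' = \<Gamma>"
    by (auto dest!: msed_map_invR)
  have "realizable \<Gamma>'' (add_mset (p @ [Ante], A) \<Delta>')"
    "realizable (add_mset (p @ [Conseq], B) \<Gamma>'') \<Delta>'"
    using impL \<Gamma>' by auto
  then show ?case
    by (rule realizable_combine) (auto simp: seq_true_def \<Gamma>')
next
  case (impR A \<Gamma> B \<Delta>)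
  then obtain p \<Delta>'' where \<Delta>': "\<Delta>' = add_mset (p, MImp A B) \<Delta>''" "image_mset snd \<Delta>'' = \<Delta>"
    by (auto dest!: msed_map_invR)
  have "realizable (add_mset (p @ [Ante], A) \<Gamma>') (add_mset (p @ [Conseq], B) \<Delta>'')"
    using impR \<Delta>' by auto
  then show ?case
    by (rule realizable_mono) (auto simp: seq_true_def \<Delta>')
next
  case (weakL \<Gamma> \<Delta> A)
  then obtain p \<Gamma>'' where \<Gamma>': "\<Gamma>' = add_mset (p, A) \<Gamma>''" "image_mset snd \<Gamma>'' = \<Gamma>"
    by (auto dest!: msed_map_invR)
  with weakL have "realizable \<Gamma>'' \<Delta>'" by auto
  then show ?case
    by (rule realizable_mono) (auto simp: seq_true_def \<Gamma>')
next
  case (weakR \<Gamma> \<Delta> A)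
  then obtain p \<Delta>'' where \<Delta>': "\<Delta>' = add_mset (p, A) \<Delta>''" "image_mset snd \<Delta>'' = \<Delta>"
    by (auto dest!: msed_map_invR)
  with weakR have "realizable \<Gamma>' \<Delta>''" by auto
  then show ?case
    by (rule realizable_mono) (auto simp: seq_true_def \<Delta>')
next
  case (contrL A \<Gamma> \<Delta>)
  then obtain p \<Gamma>'' where \<Gamma>': "\<Gamma>' = add_mset (p, A) \<Gamma>''" "image_mset snd \<Gamma>'' = \<Gamma>"
    by (auto dest!: msed_map_invR)
  \<comment> \<open>Both copies keep the label \<open>p\<close>, hence the same variables.\<close>
  with contrL have "realizable (add_mset (p, A) \<Gamma>') \<Delta>'" by auto
  then show ?case
    by (rule realizable_mono) (auto simp: seq_true_def \<Gamma>')
next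
  case (contrR \<Gamma> A \<Delta>)
  then obtain p \<Delta>'' where \<Delta>': "\<Delta>' = add_mset (p, A) \<Delta>''" "image_mset snd \<Delta>'' = \<Delta>"
    by (auto dest!: msed_map_invR)
  with contrR have "realizable \<Gamma>' (add_mset (p, A) \<Delta>')" by auto
  then show ?case
    by (rule realizable_mono) (auto simp: seq_true_def \<Delta>')
next
  case (RM A B)
  then obtain p q where "\<Gamma>' = {#(p, MBox A)#}" "\<Delta>' = {#(q, MBox B)#}"
    by (auto dest!: msed_map_invR)
  moreover have "realizable {#(p @ [Body], A)#} {#(q @ [Body], B)#}"
    using RM by simp
  ultimately show ?case using realizable_RM by simp
qed

lemma GM_realization:
  assumes "GM {#} {#A#}"
  shows "\<exists>N \<phi>. JEM CS (subst (resolve N \<phi>) (annotate True [] A))"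
proof -
  have "realizable {#} {#([], A)#}"
    using GM_realizable[OF assms] by simp
  \<comment> \<open>The whole derivation forms one block, so \<open>N = k\<close> and
    \<open>a = 0\<close>.\<close>
  then obtain k where "realizable_at k {0..<k} {#} {#([], A)#}"
    unfolding realizable_def by (metis add_0 order_refl)
  then obtain \<phi> F where "uniform (resolutions k {0..<k} \<phi>) (\<lambda>\<theta>. subst \<theta> F)"
    "\<And>W. beval W F \<Longrightarrow> beval W (annotate True [] A)"
    by (auto simp: realizable_at_def seq_true_def)
  then have "uniform (resolutions k {0..<k} \<phi>) (\<lambda>\<theta>. subst \<theta> (annotate True [] A))"
    by (rule uniform_taut_conseq)
  then show ?thesis
    unfolding uniform_def using resolve_in_resolutions JEM_reflect by blast
qed

end

section \<open>Normality\<close>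

lemma forget_subst_annotate: "forget (subst \<theta> (annotate s p A)) = A"
  by (induction A arbitrary: s p) auto

primrec prf_free :: "'p jfm \<Rightarrow> bool" where
  "prf_free (JAtom P) = True"
| "prf_free JBot = True"
| "prf_free (F \<^bold>\<rightarrow> G) = (prf_free F \<and> prf_free G)"
| "prf_free (JPrf l F) = False"
| "prf_free (JBox t F) = prf_free F"

lemma prf_free_jocc: "jocc F p G \<Longrightarrow> prf_free F \<Longrightarrow> prf_free G"
  by (induction rule: jocc.induct) auto

lemma prf_free_subst_annotate: "prf_free (subst \<theta> (annotate s p A))"
  by (induction A arbitrary: s p) auto

lemma subst_annotate_FmJ: "subst \<theta> (annotate s p A) \<in> FmJ"
  unfolding FmJ_def using prf_free_jocc[OF _ prf_free_subst_annotate] by fastforce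

text \<open>\<open>annotate\<close> updates path and polarity as \<open>mocc\<close> does, and
  substitution changes only terms.\<close>

lemma jocc_subst_annotate:
  "mocc A p s B \<Longrightarrow> jocc (subst \<theta> (annotate True [] A)) p (subst \<theta> (annotate s p B))"
  by (induction rule: mocc.induct) (auto intro: jocc.intros)

lemma neg_box_variable:
  assumes "p \<in> neg_boxes A"
  shows "\<exists>G. jocc (subst (resolve N \<phi>) (annotate True [] A)) p (JBox (JVar (box_var False p)) G)"
proof -
  obtain B where "mocc A p False (MBox B)"
    using assms by (auto simp: neg_boxes_def)
  from jocc_subst_annotate[OF this, of "resolve N \<phi>"] show ?thesis
    by (auto simp: resolve_neg)
qed

theorem mainTheorem8:
  fixes CS :: "'p::countable const_spec"
  assumes "constant_specification CS"
    and "axiomatically_appropriate CS"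
    and "schematic CS"
  shows "\<exists>r. realization r \<and> normal r \<and> (\<forall>A. GM {#} {#A#} \<longrightarrow> JEM CS (r A))"
proof -
  interpret schematic_spec CS using assms(2,3) by unfold_locales
  \<comment> \<open>With the implication inside the existentials, \<open>N\<close> and
    \<open>\<phi>\<close> exist for unprovable \<open>A\<close> too; any values give a normal
    realization there.\<close>
  have "\<forall>A. \<exists>N \<phi>. GM {#} {#A#} \<longrightarrow> JEM CS (subst (resolve N \<phi>) (annotate True [] A))"
    using GM_realization by blast
  then obtain N \<phi> where
    provable: "\<And>A. GM {#} {#A#} \<Longrightarrow> JEM CS (subst (resolve (N A) (\<phi> A)) (annotate True [] A))"
    by metis
  define r where "r A = subst (resolve (N A) (\<phi> A)) (annotate True [] A)" for A :: "'p mfm"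
  have "realization r"
    by (simp add: realization_def r_def subst_annotate_FmJ forget_subst_annotate)
  moreover have "normal r"
    unfolding normal_def r_def
    by (intro allI exI[of _ "box_var False"] conjI ballI neg_box_variable) (auto intro: inj_onI)
  moreover have "\<forall>A. GM {#} {#A#} \<longrightarrow> JEM CS (r A)"
    using provable by (simp add: r_def)
  ultimately show ?thesis by blast
qed

end
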